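(* Let $1\le p<\infty$. For each $t\in[0,1)$ the spectra of the bounded operator $C_t\colon H^p\to H^p$ are given by $$\sigma_{pt}(C_t;H^p)=\left\{\frac{1}{m+1}: m\in\mathbb{N}_0\right\}$$ and $$\sigma(C_t;H^p)=\left\{\frac{1}{m+1}: m\in\mathbb{N}_0\right\}\cup\{0\}.$$
   Context: Let $\mathbb{N}_0=\{0,1,2,\ldots\}$, $\mathbb{D}=\{z\in\mathbb{C}:|z|<1\}$ and let $H(\mathbb{D})$ be the space of holomorphic functions on $\mathbb{D}$. For $1\le p<\infty$ the Hardy space $H^p$ is the Banach space of all $f\in H(\mathbb{D})$ with $\|f\|_p:=\sup_{0\le r<1}\left(\frac{1}{2\pi}\int_0^{2\pi}|f(re^{i\theta})|^p\,d\theta\right)^{1/p}<\infty$. For $t\in[0,1)$ the generalized Cesàro operator $C_t\colon H(\mathbb{D})\to H(\mathbb{D})$ is defined by $(C_tf)(0):=f(0)$ and $(C_tf)(z):=\frac1z\int_0^z\frac{f(\xi)}{1-t\xi}\,d\xi$ for $z\in\mathbb{D}\setminus\{0\}$; it acts continuously on $H^p$. For a bounded linear operator $T$ on a complex Banach space $X$, $\sigma(T;X)$ is the set of $\lambda\in\mathbb{C}$ such that $\lambda I-T$ has no bounded inverse on $X$, and $\sigma_{pt}(T;X)$ (the point spectrum) is the set of $\lambda\in\mathbb{C}$ such that $\lambda I-T$ is not injective. *)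

theory Defs
  imports "HOL-Complex_Analysis.Complex_Analysis"
begin

abbreviation unit_disc :: "complex set" where
  "unit_disc \<equiv> ball 0 1"

(* A function on the disc is represented by its extension by 0 to the whole plane. Hence
   equality of representatives is equality on the disc, and the vector space operations are
   the pointwise ones. *)
definition holo_disc :: "(complex \<Rightarrow> complex) set" where
  "holo_disc = {f. f holomorphic_on unit_disc \<and> (\<forall>z. z \<notin> unit_disc \<longrightarrow> f z = 0)}"

definition integral_mean :: "real \<Rightarrow> (complex \<Rightarrow> complex) \<Rightarrow> real \<Rightarrow> real" where
  "integral_mean p f r =
     (1 / (2 * pi) * integral {0..2 * pi} (\<lambda>\<theta>. cmod (f (of_real r * exp (\<i> * of_real \<theta>))) powr p))
       powr (1 / p)"

(* Only meaningful if the integral means are bounded, which membership in hardy_space requires. *)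
definition hardy_norm :: "real \<Rightarrow> (complex \<Rightarrow> complex) \<Rightarrow> real" where
  "hardy_norm p f = (SUP r\<in>{0..<1}. integral_mean p f r)"

definition hardy_space :: "real \<Rightarrow> (complex \<Rightarrow> complex) set" where
  "hardy_space p = {f \<in> holo_disc. bdd_above (integral_mean p f ` {0..<1})}"

definition cesaro :: "real \<Rightarrow> (complex \<Rightarrow> complex) \<Rightarrow> complex \<Rightarrow> complex" where
  "cesaro t f z =
     (if z \<notin> unit_disc then 0
      else if z = 0 then f 0
      else 1 / z * contour_integral (linepath 0 z) (\<lambda>\<xi>. f \<xi> / (1 - of_real t * \<xi>)))"

(* X is a complex vector space of functions under the pointwise operations and N is a norm on X.
   Operators are only looked at on X; their values elsewhere are irrelevant. *)

definition bounded_operator_on ::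
  "(complex \<Rightarrow> complex) set \<Rightarrow> ((complex \<Rightarrow> complex) \<Rightarrow> real)
    \<Rightarrow> ((complex \<Rightarrow> complex) \<Rightarrow> complex \<Rightarrow> complex) \<Rightarrow> bool" where
  "bounded_operator_on X N T \<longleftrightarrow>
     (\<forall>f\<in>X. T f \<in> X) \<and>
     (\<forall>f\<in>X. \<forall>g\<in>X. T (\<lambda>z. f z + g z) = (\<lambda>z. T f z + T g z)) \<and>
     (\<forall>c. \<forall>f\<in>X. T (\<lambda>z. c * f z) = (\<lambda>z. c * T f z)) \<and>
     (\<exists>K. \<forall>f\<in>X. N (T f) \<le> K * N f)"

definition shifted_op ::
  "((complex \<Rightarrow> complex) \<Rightarrow> complex \<Rightarrow> complex) \<Rightarrow> complex
    \<Rightarrow> (complex \<Rightarrow> complex) \<Rightarrow> complex \<Rightarrow> complex" where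
  "shifted_op T \<mu> f = (\<lambda>z. \<mu> * f z - T f z)"

definition spectrum ::
  "(complex \<Rightarrow> complex) set \<Rightarrow> ((complex \<Rightarrow> complex) \<Rightarrow> real)
    \<Rightarrow> ((complex \<Rightarrow> complex) \<Rightarrow> complex \<Rightarrow> complex) \<Rightarrow> complex set" where
  "spectrum X N T =
     {\<mu>. \<not> (\<exists>S. bounded_operator_on X N S \<and>
               (\<forall>f\<in>X. S (shifted_op T \<mu> f) = f \<and> shifted_op T \<mu> (S f) = f))}"

definition point_spectrum ::
  "(complex \<Rightarrow> complex) set \<Rightarrow> ((complex \<Rightarrow> complex) \<Rightarrow> complex \<Rightarrow> complex) \<Rightarrow> complex set" where
  "point_spectrum X T = {\<mu>. \<not> inj_on (shifted_op T \<mu>) X}"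

end

theory Submission
  imports Defs
begin

text \<open>
  Write \<open>C\<close> for the operator with parameter \<open>t\<close>. The function \<open>h = C f\<close> is characterised by
  the differential equation \<open>(z h(z))' = f(z) / (1 - t z)\<close> (lemma \<open>cesaro_eqI\<close>), so every spectral
  question becomes a first-order linear equation with a regular singular point at 0.

  Eigenvalues. If \<open>C d = \<alpha> d\<close> and \<open>z d(z) = z^n g(z)\<close> with \<open>g 0 \<noteq> 0\<close>, comparing the lowest order
  terms of the equation gives \<open>\<alpha> n = 1\<close>. Conversely \<open>z^m / (1 - t z)^(m + 1)\<close> is a bounded
  eigenfunction for \<open>1 / (m + 1)\<close>.

  The point 0. As \<open>C\<close> maps \<open>(n + 1) (1 - t z) z^n\<close> to \<open>z^n\<close>, an inverse of \<open>C\<close> would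
  multiply the norm of \<open>z^n\<close> by at least \<open>(1 - t) (n + 1)\<close> for every \<open>n\<close>.

  The resolvent. Let \<open>\<alpha> = 1 / \<mu>\<close> be nonzero and not of the form \<open>1 / (m + 1)\<close>. To solve
  \<open>\<alpha> f - C f = g\<close>, put \<open>h = C f\<close>, so that \<open>f = \<mu> (g + h)\<close>. The substitution
  \<open>h = (1 - t z)^(-\<mu>) u\<close> turns the equation for \<open>h\<close> into the Euler equation
  \<open>z u' + (1 - \<mu>) u = G\<close> with \<open>G = \<mu> (1 - t z)^(\<mu> - 1) g\<close>. It is solved coefficientwise,
  \<open>u_n = G_n / (n + 1 - \<mu>)\<close>, and no denominator vanishes. The identity
  \<open>1 / (n + 1 - \<mu>) = 1 / (n + 1) + \<mu> / ((n + 1) (n + 1 - \<mu>))\<close> splits \<open>u\<close> into two parts. The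
  first is the mean of \<open>G\<close> over the segment from 0 to \<open>z\<close>. The second has
  coefficients bounded by a constant times \<open>\<parallel>g\<parallel> / n^2\<close>, because Taylor coefficients are bounded by
  the Hardy norm; hence it is a bounded function. Altogether \<open>|f(z)|\<close> is at most a constant times
  \<open>|g(z)| + M(z) + \<parallel>g\<parallel>\<close>, where \<open>M(z)\<close> is the mean of \<open>|g|\<close> over that segment
  (lemmas \<open>euler_solution_bound\<close>, \<open>resolvent_solution\<close>).

  Such a pointwise bound suffices: by Jensen's inequality and Fubini's theorem the radial mean
  does not increase integral means, so \<open>f\<close> lies in the Hardy space with norm at most a constant
  times \<open>\<parallel>g\<parallel>\<close> (lemma \<open>hardy_space_dominated\<close>). With injectivity this makes \<open>\<alpha> I - C\<close> a
  bijection with bounded inverse.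
\<close>

section \<open>Convexity of the power function\<close>

lemma powr_ge_tangent:
  fixes p x m :: real
  assumes "1 \<le> p" "0 \<le> x" "0 \<le> m"
  shows "m powr p + p * m powr (p - 1) * (x - m) \<le> x powr p"
proof -
  consider "m = 0" | "m > 0" "x = 0" | "m > 0" "x > 0"
    using assms by linarith
  then show ?thesis
  proof cases
    case 2
    have "m powr (p - 1) * m = m powr p"
      using 2 by (simp add: powr_mult_base mult.commute)
    then show ?thesis
      using 2 assms by (simp add: algebra_simps mult_le_cancel_right1)
  next
    case 3
    have "x powr p - m powr p \<ge> (p * m powr (p - 1)) * (x - m)"
    proof (rule convex_on_imp_above_tangent[where A = "{0<..}"])
      show "((\<lambda>x. x powr p) has_field_derivative p * m powr (p - 1)) (at m within {0<..})"
        using 3 by (auto intro!: derivative_eq_intros)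
      show "m \<in> interior {0<..}"
        using 3 by (simp add: interior_open)
    qed (use 3 assms powr_convex in \<open>auto intro: convex_connected\<close>)
    then show ?thesis by simp
    (* For m = 0 the slope is 0 even if p = 1, since 0 powr a = 0 for every a. *)
  qed auto
qed

text \<open>Jensen's inequality for a continuous function. The tangent at the average \<open>m\<close> lies below the
  graph, and its linear term \<open>\<phi> x - m\<close> integrates to 0.\<close>
lemma powr_average_le:
  fixes \<phi> :: "real \<Rightarrow> real"
  assumes p: "1 \<le> p" and ab: "a < b" and cont: "continuous_on {a..b} \<phi>"
    and nonneg: "\<And>x. x \<in> {a..b} \<Longrightarrow> 0 \<le> \<phi> x"
  shows "(integral {a..b} \<phi> / (b - a)) powr p \<le> integral {a..b} (\<lambda>x. \<phi> x powr p) / (b - a)"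
proof -
  define m where "m = integral {a..b} \<phi> / (b - a)"
  have int1: "\<phi> integrable_on {a..b}"
    using cont by (rule integrable_continuous_real)
  have m0: "0 \<le> m"
    unfolding m_def using ab nonneg by (auto intro!: divide_nonneg_nonneg integral_nonneg int1)
  have contp: "continuous_on {a..b} (\<lambda>x. \<phi> x powr p)"
    using cont nonneg p by (intro continuous_on_powr') (auto intro!: continuous_intros)
  have intp: "(\<lambda>x. \<phi> x powr p) integrable_on {a..b}"
    using contp by (rule integrable_continuous_real)
  define k where "k = p * m powr (p - 1)"
  have i1: "((\<lambda>x. m powr p) has_integral (b - a) * m powr p) {a..b}"
    using has_integral_const_real[of "m powr p" a b] ab by simp
  have i2: "((\<lambda>x. m) has_integral (b - a) * m) {a..b}"
    using has_integral_const_real[of m a b] ab by simp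
  have "((\<lambda>x. m powr p + k * (\<phi> x - m)) has_integral
      ((b - a) * m powr p + k * (integral {a..b} \<phi> - (b - a) * m))) {a..b}"
    by (intro has_integral_add has_integral_mult_right has_integral_diff
          i1 i2 integrable_integral int1)
  moreover have "integral {a..b} \<phi> = (b - a) * m"
    using ab by (simp add: m_def)
  ultimately have "((\<lambda>x. m powr p + k * (\<phi> x - m)) has_integral (b - a) * m powr p) {a..b}"
    by simp
  then have "(b - a) * m powr p \<le> integral {a..b} (\<lambda>x. \<phi> x powr p)"
    by (rule has_integral_le[OF _ integrable_integral[OF intp]])
       (use powr_ge_tangent[OF p nonneg m0] in \<open>auto simp: k_def\<close>)
  then show ?thesis
    using ab by (simp add: m_def[symmetric] field_simps)
qed

text \<open>Adding the tangent inequalities at the average makes the linear terms cancel. Integrated over a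
  circle, this takes the place of Minkowski's inequality for a sum of three terms.\<close>
lemma powr_average3_le:
  fixes x y z :: real
  assumes "1 \<le> p" "0 \<le> x" "0 \<le> y" "0 \<le> z"
  shows "((x + y + z) / 3) powr p \<le> (x powr p + y powr p + z powr p) / 3"
proof -
  define m where "m = (x + y + z) / 3"
  define k where "k = p * m powr (p - 1)"
  have "0 \<le> m" using assms by (simp add: m_def)
  note tangent = powr_ge_tangent[OF assms(1) _ this, folded k_def]
  have "3 * m powr p + k * ((x - m) + (y - m) + (z - m)) \<le> x powr p + y powr p + z powr p"
    using tangent[of x] tangent[of y] tangent[of z] assms by (simp add: algebra_simps)
  moreover have "(x - m) + (y - m) + (z - m) = 0"
    by (simp add: m_def field_simps)
  ultimately show ?thesis by (simp only: m_def) simp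
qed

section \<open>Estimates in the Hardy space\<close>

abbreviation circle_integral :: "real \<Rightarrow> (complex \<Rightarrow> complex) \<Rightarrow> real \<Rightarrow> real" where
  "circle_integral p f r \<equiv>
     integral {0..2 * pi} (\<lambda>\<theta>. cmod (f (of_real r * exp (\<i> * of_real \<theta>))) powr p)"

lemma holo_disc_continuous: "f \<in> holo_disc \<Longrightarrow> continuous_on unit_disc f"
  by (simp add: holo_disc_def holomorphic_on_imp_continuous_on)

lemma circle_in_disc: "0 \<le> r \<Longrightarrow> r < 1 \<Longrightarrow> of_real r * exp (\<i> * of_real \<theta>) \<in> unit_disc"
  by (simp add: norm_mult)

lemma continuous_on_circle:
  assumes "f \<in> holo_disc" "0 \<le> r" "r < 1"
  shows "continuous_on A (\<lambda>\<theta>. cmod (f (of_real r * exp (\<i> * of_real \<theta>))))"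
  using assms
  by (intro continuous_intros continuous_on_compose2[OF holo_disc_continuous[OF assms(1)]])
     (auto simp: norm_mult)

lemma continuous_on_circle_powr:
  assumes "f \<in> holo_disc" "0 \<le> r" "r < 1" "1 \<le> p"
  shows "continuous_on A (\<lambda>\<theta>. cmod (f (of_real r * exp (\<i> * of_real \<theta>))) powr p)"
  using assms by (intro continuous_on_powr' continuous_on_circle continuous_intros) auto

lemma circle_powr_integrable:
  assumes "f \<in> holo_disc" "0 \<le> r" "r < 1" "1 \<le> p"
  shows "(\<lambda>\<theta>. cmod (f (of_real r * exp (\<i> * of_real \<theta>))) powr p) integrable_on {0..2*pi}"
  using continuous_on_circle_powr[OF assms] by (rule integrable_continuous_real)

lemma circle_integral_nonneg: "0 \<le> circle_integral p f r"
proof (cases "(\<lambda>\<theta>. cmod (f (of_real r * exp (\<i> * of_real \<theta>))) powr p) integrable_on {0..2*pi}")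
  case True
  then show ?thesis by (rule Henstock_Kurzweil_Integration.integral_nonneg) simp
qed (simp add: not_integrable_integral)

lemma integral_mean_le_hardy_norm:
  assumes "f \<in> hardy_space p" "0 \<le> r" "r < 1"
  shows "integral_mean p f r \<le> hardy_norm p f"
  using assms unfolding hardy_space_def hardy_norm_def by (auto intro!: cSUP_upper)

lemma hardy_norm_nonneg:
  assumes "f \<in> hardy_space p" shows "0 \<le> hardy_norm p f"
  using integral_mean_le_hardy_norm[OF assms, of 0]
  by (rule order_trans[rotated]) (auto simp: integral_mean_def)

lemma circle_integral_le:
  assumes p: "1 \<le> p" and f: "f \<in> hardy_space p" and r: "0 \<le> r" "r < 1"
  shows "circle_integral p f r \<le> 2 * pi * hardy_norm p f powr p"
proof -
  have "integral_mean p f r powr p \<le> hardy_norm p f powr p"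
    using integral_mean_le_hardy_norm[OF f r] p by (intro powr_mono2) (auto simp: integral_mean_def)
  then show ?thesis
    using p circle_integral_nonneg[where p = p and f = f and r = r]
    by (simp add: integral_mean_def powr_powr field_simps)
qed

text \<open>Estimates are reduced to the integral over each circle, so
  that suprema and \<open>p\<close>-th roots need not be handled again.\<close>
lemma hardy_spaceI:
  assumes p: "1 \<le> p" and F: "F \<in> holo_disc" and B: "0 \<le> B"
    and le: "\<And>r. 0 \<le> r \<Longrightarrow> r < 1 \<Longrightarrow> circle_integral p F r \<le> 2 * pi * B powr p"
  shows "F \<in> hardy_space p" and "hardy_norm p F \<le> B"
proof -
  have *: "integral_mean p F r \<le> B" if "r \<in> {0..<1}" for r
  proof -
    have "integral_mean p F r \<le> (B powr p) powr (1 / p)"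
      unfolding integral_mean_def
      using that le[of r] circle_integral_nonneg[where p = p and f = F and r = r] p
      by (intro powr_mono2) (auto simp: field_simps)
    also have "\<dots> = B"
      using p B by (simp add: powr_powr)
    finally show ?thesis .
  qed
  then show "F \<in> hardy_space p"
    using F by (auto simp: hardy_space_def intro: bdd_aboveI2[where M = B])
  show "hardy_norm p F \<le> B"
    unfolding hardy_norm_def using * by (intro cSUP_least) auto
qed

lemma hardy_space_bounded:
  assumes p: "1 \<le> p" and F: "F \<in> holo_disc" and B: "\<And>z. z \<in> unit_disc \<Longrightarrow> cmod (F z) \<le> B"
  shows "F \<in> hardy_space p" and "hardy_norm p F \<le> B"
proof -
  have B0: "0 \<le> B" using order_trans[OF norm_ge_zero B[of 0]] by simp
  have le: "circle_integral p F r \<le> 2 * pi * B powr p" if r: "0 \<le> r" "r < 1" for r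
  proof -
    have "circle_integral p F r \<le> integral {0..2*pi} (\<lambda>_. B powr p)"
      using p by (intro integral_le circle_powr_integrable F r p integrable_const_ivl powr_mono2 B
            circle_in_disc) auto
    then show ?thesis by simp
  qed
  show "F \<in> hardy_space p" "hardy_norm p F \<le> B"
    using hardy_spaceI[OF p F B0 le] by auto
qed

text \<open>A lower bound on a single circle suffices; it serves to show that certain functions have large
  norm.\<close>
lemma hardy_norm_ge:
  assumes p: "1 \<le> p" and f: "f \<in> hardy_space p" and r: "0 \<le> r" "r < 1" and c: "0 \<le> c"
    and le: "\<And>z. cmod z = r \<Longrightarrow> c \<le> cmod (f z)"
  shows "c \<le> hardy_norm p f"
proof -
  have "f \<in> holo_disc" using f by (simp add: hardy_space_def)
  have "integral {0..2*pi} (\<lambda>_. c powr p) \<le> circle_integral p f r"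
    using p c r by (intro integral_le circle_powr_integrable r p \<open>f \<in> holo_disc\<close>
      integrable_const_ivl powr_mono2 le) (auto simp: norm_mult)
  also have "\<dots> \<le> 2 * pi * hardy_norm p f powr p"
    by (rule circle_integral_le[OF p f r])
  finally have "c powr p \<le> hardy_norm p f powr p" by simp
  then show ?thesis
    using p c hardy_norm_nonneg[OF f] powr_less_mono2[of p "hardy_norm p f" c] by linarith
qed

text \<open>The triangle inequality is replaced by a cruder one with constant 3, which comes from
  \<open>powr_average3_le\<close> with the third term equal to 0.\<close>
lemma hardy_space_add:
  assumes p: "1 \<le> p" and f: "f \<in> hardy_space p" and g: "g \<in> hardy_space p"
  shows "(\<lambda>z. f z + g z) \<in> hardy_space p"
proof -
  define M where "M = max (hardy_norm p f) (hardy_norm p g)"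
  have fg: "f \<in> holo_disc" "g \<in> holo_disc" using f g by (auto simp: hardy_space_def)
  have M: "0 \<le> M" using hardy_norm_nonneg[OF f] by (simp add: M_def)
  have holo: "(\<lambda>z. f z + g z) \<in> holo_disc"
    using fg by (auto simp: holo_disc_def intro: holomorphic_intros)
  have "circle_integral p (\<lambda>z. f z + g z) r \<le> 2 * pi * (3 * M) powr p" if r: "0 \<le> r" "r < 1" for r
  proof -
    let ?e = "\<lambda>\<theta>. of_real r * exp (\<i> * of_real \<theta>)"
    have pt: "cmod (f z + g z) powr p
        \<le> 3 powr p / 3 * (cmod (f z) powr p + cmod (g z) powr p)" for z
    proof -
      have "cmod (f z + g z) powr p \<le> (3 * ((cmod (f z) + cmod (g z) + 0) / 3)) powr p"
        using p norm_triangle_ineq[of "f z" "g z"] by (intro powr_mono2) auto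
      also have "\<dots> = 3 powr p * ((cmod (f z) + cmod (g z) + 0) / 3) powr p"
        by (rule powr_mult)
      also have "\<dots> \<le> 3 powr p * ((cmod (f z) powr p + cmod (g z) powr p + 0 powr p) / 3)"
        by (intro mult_left_mono powr_average3_le p) auto
      finally show ?thesis by simp
    qed
    have "circle_integral p (\<lambda>z. f z + g z) r
        \<le> integral {0..2*pi} (\<lambda>\<theta>. 3 powr p / 3 * (cmod (f (?e \<theta>)) powr p + cmod (g (?e \<theta>)) powr p))"
      by (intro integral_le circle_powr_integrable[OF holo r p] integrable_on_mult_right
            integrable_add circle_powr_integrable fg r p pt)
    also have "\<dots> = 3 powr p / 3 * (circle_integral p f r + circle_integral p g r)"
      by (simp add: integral_add circle_powr_integrable fg r p)
    also have "\<dots> \<le> 3 powr p / 3 * (2 * pi * M powr p + 2 * pi * M powr p)"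
      using p hardy_norm_nonneg f g unfolding M_def
      by (intro mult_left_mono add_mono order_trans[OF circle_integral_le[OF p _ r]] powr_mono2) auto
    also have "\<dots> \<le> 3 powr p / 3 * (6 * pi * M powr p)"
      by (intro mult_left_mono) auto
    also have "\<dots> = 2 * pi * (3 * M) powr p"
      using M by (simp add: powr_mult)
    finally show ?thesis .
  qed
  then show ?thesis
    using hardy_spaceI[OF p holo, of "3 * M"] M by auto
qed

lemma scaled_in_disc: "s \<in> {0..1} \<Longrightarrow> z \<in> unit_disc \<Longrightarrow> of_real s * z \<in> unit_disc"
  by (auto simp: norm_mult intro: le_less_trans[OF mult_left_le_one_le])

abbreviation radial_mean :: "(complex \<Rightarrow> complex) \<Rightarrow> complex \<Rightarrow> real" where
  "radial_mean f z \<equiv> integral {0..1} (\<lambda>s. cmod (f (of_real s * z)))"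

lemma continuous_on_radius:
  assumes "f \<in> holo_disc" "z \<in> unit_disc"
  shows "continuous_on {0..1} (\<lambda>s. cmod (f (of_real s * z)))"
  using assms
  by (intro continuous_intros continuous_on_compose2[OF holo_disc_continuous[OF assms(1)]])
     (auto intro!: scaled_in_disc simp del: mem_ball)

lemma radial_mean_nonneg:
  assumes "f \<in> holo_disc" "z \<in> unit_disc"
  shows "0 \<le> radial_mean f z"
  by (rule Henstock_Kurzweil_Integration.integral_nonneg)
     (auto intro: integrable_continuous_real continuous_on_radius[OF assms])

text \<open>Jensen's inequality on each radius bounds the \<open>p\<close>-th power of the mean by the mean of
  \<open>|f|^p\<close>. After interchanging the integrals, the inner one runs over the circle of radius
  \<open>s r\<close>, where the Hardy norm controls it uniformly in \<open>s\<close>.\<close>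
lemma integral_radial_mean_powr_le:
  assumes p: "1 \<le> p" and f: "f \<in> hardy_space p" and r: "0 \<le> r" "r < 1"
  defines "R \<equiv> \<lambda>\<theta>. radial_mean f (of_real r * exp (\<i> * of_real \<theta>))"
  shows "continuous_on {0..2 * pi} R"
    and "integral {0..2*pi} (\<lambda>\<theta>. R \<theta> powr p) \<le> 2 * pi * hardy_norm p f powr p"
proof -
  have f': "f \<in> holo_disc" using f by (simp add: hardy_space_def)
  have cont2: "continuous_on A (\<lambda>(\<theta>, s). cmod (f (of_real s * (of_real r * exp (\<i> * of_real \<theta>)))))"
    if "A \<subseteq> UNIV \<times> {0..1}" for A :: "(real \<times> real) set"
    using that r unfolding split_def
    by (intro continuous_intros continuous_on_compose2[OF holo_disc_continuous[OF f']])
       (auto intro!: scaled_in_disc circle_in_disc simp del: mem_ball)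
  have cont2p: "continuous_on A (\<lambda>(\<theta>, s). cmod (f (of_real s * (of_real r * exp (\<i> * of_real \<theta>)))) powr p)"
    if "A \<subseteq> UNIV \<times> {0..1}" for A :: "(real \<times> real) set"
    using cont2[OF that] p unfolding split_def by (intro continuous_on_powr')
        (auto intro: continuous_intros)
  show contR: "continuous_on {0..2 * pi} R"
    unfolding R_def
    using integral_continuous_on_param[of "{0..2*pi}" "0::real" 1
        "\<lambda>\<theta> s. cmod (f (of_real s * (of_real r * exp (\<i> * of_real \<theta>))))"]
      cont2[OF Sigma_mono[OF subset_UNIV order_refl]] by simp
  have R0: "0 \<le> R \<theta>" for \<theta>
    unfolding R_def by (rule radial_mean_nonneg[OF f' circle_in_disc[OF r]])
  have contRp: "continuous_on {0..2 * pi} (\<lambda>\<theta>. R \<theta> powr p)"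
    using contR R0 p by (intro continuous_on_powr') (auto intro: continuous_intros)
  let ?G = "\<lambda>\<theta> s. cmod (f (of_real s * (of_real r * exp (\<i> * of_real \<theta>)))) powr p"
  have "integral {0..2*pi} (\<lambda>\<theta>. R \<theta> powr p) \<le> integral {0..2*pi} (\<lambda>\<theta>. integral {0..1} (?G \<theta>))"
  proof (rule integral_le)
    show "(\<lambda>\<theta>. integral {0..1} (?G \<theta>)) integrable_on {0..2*pi}"
      using integral_continuous_on_param[of "{0..2*pi}" "0::real" 1 ?G]
        cont2p[OF Sigma_mono[OF subset_UNIV order_refl]] by (intro integrable_continuous_real) simp
    show "R \<theta> powr p \<le> integral {0..1} (?G \<theta>)" for \<theta>
      using powr_average_le[OF p, of 0 1, OF _ continuous_on_radius[OF f' circle_in_disc[OF r]]]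
      by (simp add: R_def)
  qed (rule integrable_continuous_real[OF contRp])
  also have "\<dots> = integral {0..1} (\<lambda>s. integral {0..2*pi} (\<lambda>\<theta>. ?G \<theta> s))"
    using integral_swap_continuous[of 0 0 "2*pi" "1::real" ?G] cont2p[of "cbox (0,0) (2*pi,1)"]
    by (auto simp: cbox_Pair_eq)
  also have "\<dots> \<le> integral {0..1::real} (\<lambda>s. 2 * pi * hardy_norm p f powr p)"
  proof (rule integral_le)
    have "continuous_on (({0..1::real}) \<times> {0..2*pi}) (\<lambda>(s,\<theta>). ?G \<theta> s)"
      using continuous_on_compose2[OF cont2p[OF Sigma_mono[OF subset_UNIV order_refl]]
          continuous_on_swap, of "{0..1} \<times> {0..2*pi}" "{0..2*pi}"]
      by (simp add: split_def product_swap)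
    then show "(\<lambda>s. integral {0..2*pi} (\<lambda>\<theta>. ?G \<theta> s)) integrable_on {0..1}"
      using integral_continuous_on_param[of "{0..1::real}" 0 "2*pi" "\<lambda>s \<theta>. ?G \<theta> s"]
      by (intro integrable_continuous_real) simp
    show "integral {0..2*pi} (\<lambda>\<theta>. ?G \<theta> s) \<le> 2 * pi * hardy_norm p f powr p" if "s \<in> {0..1}" for s
    proof -
      have "s * r < 1" using that r by (auto intro: le_less_trans[OF mult_left_le_one_le])
      then show ?thesis
        using circle_integral_le[OF p f, of "s * r"] that r by (simp add: mult.assoc)
    qed
  qed auto
  finally show "integral {0..2*pi} (\<lambda>\<theta>. R \<theta> powr p) \<le> 2 * pi * hardy_norm p f powr p"
    by simp
qed

text \<open>This lemma turns the pointwise bound for a solution of the resolvent equation into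
  boundedness of the resolvent: each of the three terms on the right has \<open>p\<close>-integral at most
  \<open>2 \<pi> \<parallel>f\<parallel>^p\<close> over every circle.\<close>
lemma hardy_space_dominated:
  assumes p: "1 \<le> p" and f: "f \<in> hardy_space p" and F: "F \<in> holo_disc" and K: "0 \<le> K"
    and dom: "\<And>z. z \<in> unit_disc \<Longrightarrow>
      cmod (F z) \<le> K * (cmod (f z) + radial_mean f z + hardy_norm p f)"
  shows "F \<in> hardy_space p" and "hardy_norm p F \<le> 3 * K * hardy_norm p f"
proof -
  let ?N = "hardy_norm p f"
  have f': "f \<in> holo_disc" using f by (simp add: hardy_space_def)
  have N: "0 \<le> ?N" using hardy_norm_nonneg[OF f] .
  have "circle_integral p F r \<le> 2 * pi * (3 * K * ?N) powr p" if r: "0 \<le> r" "r < 1" for r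
  proof -
    let ?e = "\<lambda>\<theta>. of_real r * exp (\<i> * of_real \<theta>)"
    define R where "R \<theta> = radial_mean f (?e \<theta>)" for \<theta>
    note R = integral_radial_mean_powr_le[OF p f r, folded R_def]
    have R0: "0 \<le> R \<theta>" for \<theta>
      unfolding R_def by (rule radial_mean_nonneg[OF f' circle_in_disc[OF r]])
    have intR: "(\<lambda>\<theta>. R \<theta> powr p) integrable_on {0..2*pi}"
      using R(1) R0 p by (intro integrable_continuous_real continuous_on_powr')
          (auto intro: continuous_intros)
    have pt: "cmod (F (?e \<theta>)) powr p
        \<le> (3 * K) powr p / 3 * (cmod (f (?e \<theta>)) powr p + R \<theta> powr p + ?N powr p)" for \<theta>
    proof -
      let ?a = "(cmod (f (?e \<theta>)) + R \<theta> + ?N) / 3"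
      have "cmod (F (?e \<theta>)) powr p \<le> (3 * K * ?a) powr p"
        using p dom[OF circle_in_disc[OF r], of \<theta>] by (intro powr_mono2) (auto simp: R_def)
      also have "\<dots> = (3 * K) powr p * ?a powr p"
        by (rule powr_mult)
      also have "\<dots> \<le> (3 * K) powr p * ((cmod (f (?e \<theta>)) powr p + R \<theta> powr p + ?N powr p) / 3)"
        using R0[of \<theta>] N by (intro mult_left_mono powr_average3_le p) auto
      finally show ?thesis by simp
    qed
    have "circle_integral p F r \<le> integral {0..2*pi}
        (\<lambda>\<theta>. (3 * K) powr p / 3 * (cmod (f (?e \<theta>)) powr p + R \<theta> powr p + ?N powr p))"
      by (intro integral_le circle_powr_integrable[OF F r p] integrable_on_mult_right
            integrable_add circle_powr_integrable f' r p pt intR integrable_const_ivl)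
    also have "\<dots> = (3 * K) powr p / 3 *
        (circle_integral p f r + integral {0..2*pi} (\<lambda>\<theta>. R \<theta> powr p) + 2 * pi * ?N powr p)"
      using integral_add[OF integrable_add[OF circle_powr_integrable[OF f' r p] intR]
          integrable_const_ivl[where c = "?N powr p"]]
        integral_add[OF circle_powr_integrable[OF f' r p] intR] by simp
    also have "\<dots> \<le> (3 * K) powr p / 3 * (2 * pi * ?N powr p + 2 * pi * ?N powr p + 2 * pi * ?N powr p)"
      by (intro mult_left_mono add_mono order_refl circle_integral_le[OF p f r] R(2)) auto
    also have "\<dots> = 2 * pi * (3 * K * ?N) powr p"
      using K N by (simp add: powr_mult)
    finally show ?thesis .
  qed
  then show "F \<in> hardy_space p" "hardy_norm p F \<le> 3 * K * hardy_norm p f"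
    using hardy_spaceI[OF p F, of "3 * K * ?N"] K N by auto
qed

lemma hardy_space_scale:
  assumes p: "1 \<le> p" and f: "f \<in> hardy_space p"
  shows "(\<lambda>z. c * f z) \<in> hardy_space p"
proof (rule hardy_space_dominated(1)[OF p f, of _ "cmod c"])
  have f': "f \<in> holo_disc" using f by (simp add: hardy_space_def)
  then show "(\<lambda>z. c * f z) \<in> holo_disc"
    by (auto simp: holo_disc_def intro: holomorphic_intros)
  show "cmod (c * f z) \<le> cmod c * (cmod (f z) + radial_mean f z + hardy_norm p f)"
    if "z \<in> unit_disc" for z
  proof -
    have "0 \<le> radial_mean f z"
      by (rule radial_mean_nonneg[OF f' that])
    then show ?thesis
      using hardy_norm_nonneg[OF f] by (auto simp: norm_mult intro!: mult_left_mono)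
  qed
qed auto

section \<open>Taylor coefficients of functions dominated by a Hardy function\<close>

lemma le_by_radial_limit:
  fixes c K :: real
  assumes "\<And>r. 0 < r \<Longrightarrow> r < 1 \<Longrightarrow> c * r ^ n \<le> K"
  shows "c \<le> K"
proof (rule tendsto_upperbound)
  have "((\<lambda>r. c * r ^ n) \<longlongrightarrow> c * 1 ^ n) (at_left 1)"
    by (intro tendsto_intros)
  then show "((\<lambda>r. c * r ^ n) \<longlongrightarrow> c) (at_left 1)" by simp
  show "\<forall>\<^sub>F r in at_left 1. c * r ^ n \<le> K"
    using eventually_at_left_real[of 0 "1::real"] by (rule eventually_mono) (auto intro: assms)
qed simp

lemma circle_mean_le_hardy_norm:
  assumes p: "1 \<le> p" and f: "f \<in> hardy_space p" and r: "0 \<le> r" "r < 1"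
  shows "integral {0..2*pi} (\<lambda>\<theta>. cmod (f (of_real r * exp (\<i> * of_real \<theta>))))
      \<le> 2 * pi * hardy_norm p f"
proof -
  have f': "f \<in> holo_disc" using f by (simp add: hardy_space_def)
  define I where "I = integral {0..2*pi} (\<lambda>\<theta>. cmod (f (of_real r * exp (\<i> * of_real \<theta>))))"
  have I0: "0 \<le> I"
    unfolding I_def
    by (rule Henstock_Kurzweil_Integration.integral_nonneg)
       (auto intro!: integrable_continuous_real continuous_on_circle f' r)
  have "(I / (2 * pi)) powr p \<le> circle_integral p f r / (2 * pi)"
    using powr_average_le[OF p, of 0 "2*pi", OF _ continuous_on_circle[OF f' r]]
    by (simp add: I_def)
  also have "\<dots> \<le> hardy_norm p f powr p"
    using circle_integral_le[OF p f r] by (simp add: field_simps)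
  finally have "I / (2 * pi) \<le> hardy_norm p f"
    using p I0 hardy_norm_nonneg[OF f] powr_less_mono2[of p "hardy_norm p f" "I / (2 * pi)"]
        by linarith
  then show ?thesis by (simp add: I_def field_simps)
qed

text \<open>Cauchy's formula on the circle of radius \<open>r\<close> bounds the coefficient times \<open>r^n\<close> by the
  mean of \<open>|G|\<close>, hence by the mean of \<open>C |g|\<close>; then \<open>r\<close> tends to 1.\<close>
lemma taylor_coeff_le_hardy_norm:
  assumes p: "1 \<le> p" and g: "g \<in> hardy_space p" and G: "G holomorphic_on unit_disc"
    and C: "0 \<le> C" and le: "\<And>z. z \<in> unit_disc \<Longrightarrow> cmod (G z) \<le> C * cmod (g z)"
  shows "cmod ((deriv ^^ n) G 0 / fact n) \<le> C * hardy_norm p g"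
proof (rule le_by_radial_limit)
  fix r :: real assume r: "0 < r" "r < 1"
  define a where "a = (deriv ^^ n) G 0 / fact n"
  have g': "g \<in> holo_disc" using g by (simp add: hardy_space_def)
  let ?e = "\<lambda>\<theta>. of_real r * exp (\<i> * of_real \<theta>)"
  have "((\<lambda>u. G u / (u - 0) ^ Suc n)
      has_contour_integral ((2 * pi * \<i>) / (fact n) * (deriv ^^ n) G 0)) (circlepath 0 r)"
    using r G by (intro Cauchy_has_contour_integral_higher_derivative_circlepath)
       (auto intro: holomorphic_on_subset holomorphic_on_imp_continuous_on
          continuous_on_subset[OF holomorphic_on_imp_continuous_on[OF G]])
  then have int: "((\<lambda>\<theta>. G (?e \<theta>) / ?e \<theta> ^ Suc n * of_real r * \<i> * exp (\<i> * of_real \<theta>))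
      has_integral 2 * of_real pi * \<i> * a) {0..2*pi}"
    by (simp add: circlepath_def has_contour_integral_part_circlepath_iff cis_conv_exp a_def)
  have eq: "cmod (G (?e \<theta>) / ?e \<theta> ^ Suc n * of_real r * \<i> * exp (\<i> * of_real \<theta>))
      = cmod (G (?e \<theta>)) / r ^ n" for \<theta>
    using r by (simp add: norm_mult norm_divide norm_power)
  have "cmod (integral {0..2*pi} (\<lambda>\<theta>. G (?e \<theta>) / ?e \<theta> ^ Suc n * of_real r * \<i> * exp (\<i> * of_real \<theta>)))
      \<le> integral {0..2*pi} (\<lambda>\<theta>. C / r ^ n * cmod (g (?e \<theta>)))"
  proof (rule integral_norm_bound_integral)
    show "(\<lambda>\<theta>. C / r ^ n * cmod (g (?e \<theta>))) integrable_on {0..2*pi}"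
      using r by (intro integrable_on_mult_right integrable_continuous_real
          continuous_on_circle[OF g']) auto
    show "cmod (G (?e \<theta>) / ?e \<theta> ^ Suc n * of_real r * \<i> * exp (\<i> * of_real \<theta>))
        \<le> C / r ^ n * cmod (g (?e \<theta>))" for \<theta>
      unfolding eq using le[OF circle_in_disc[of r \<theta>]] r by (simp add: field_simps)
  qed (use int in blast)
  also have "\<dots> \<le> C / r ^ n * (2 * pi * hardy_norm p g)"
    using circle_mean_le_hardy_norm[OF p g, of r] r C
        by (simp add: mult_left_mono divide_right_mono)
  finally have "2 * pi * cmod a \<le> C / r ^ n * (2 * pi * hardy_norm p g)"
    using integral_unique[OF int] by (simp add: norm_mult)
  then show "cmod ((deriv ^^ n) G 0 / fact n) * r ^ n \<le> C * hardy_norm p g"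
    unfolding a_def[symmetric] using r by (simp add: field_simps)
qed

section \<open>The Euler operator and the Cesaro operator\<close>

text \<open>The Euler operator \<open>B \<mapsto> z B' + c B\<close> multiplies the \<open>n\<close>-th coefficient by \<open>n + c\<close>, so it is
  inverted by division. The divisors have modulus at least 1 from some index on, hence
  the quotient series converges on the whole disc.\<close>
lemma euler_equation_solution:
  fixes a :: "nat \<Rightarrow> complex" and c :: complex
  assumes nz: "\<And>n. of_nat n + c \<noteq> 0"
    and A: "\<And>z. z \<in> unit_disc \<Longrightarrow> (\<lambda>n. a n * z ^ n) sums A z"
  obtains B B' where
    "\<And>z. z \<in> unit_disc \<Longrightarrow> (\<lambda>n. a n / (of_nat n + c) * z ^ n) sums B z"
    "\<And>z. z \<in> unit_disc \<Longrightarrow> (B has_field_derivative B' z) (at z)"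
    "\<And>z. z \<in> unit_disc \<Longrightarrow> z * B' z + c * B z = A z"
proof -
  define b where "b = (\<lambda>n. a n / (of_nat n + c))"
  have summ: "summable (\<lambda>n. b n * z ^ n)" if z: "cmod z < 1" for z
  proof (rule summable_norm_cancel, rule summable_comparison_test_ev)
    obtain x :: real where x: "cmod z < x" "x < 1" using dense[OF z] by blast
    have "0 < x" using x norm_ge_zero[of z] by linarith
    then show "summable (\<lambda>n. norm (a n * z ^ n))"
      using x sums_summable[OF A[of "of_real x"]] by (intro powser_insidea[of _ "of_real x"]) auto
    show "\<forall>\<^sub>F n in sequentially. norm (norm (b n * z ^ n)) \<le> norm (a n * z ^ n)"
      using eventually_ge_at_top[of "nat \<lceil>1 + cmod c\<rceil>"]
    proof (rule eventually_mono)
      fix n assume "nat \<lceil>1 + cmod c\<rceil> \<le> n"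
      then have "1 \<le> cmod (of_nat n + c)"
        using norm_diff_ineq[of "of_nat n" c] by (simp add: nat_le_iff ceiling_le_iff)
      then have "cmod (b n) \<le> cmod (a n)"
        unfolding b_def norm_divide
            by (metis div_by_1 frac_le norm_ge_zero order_refl zero_less_one)
      then show "norm (norm (b n * z ^ n)) \<le> norm (a n * z ^ n)"
        by (simp add: norm_mult mult_right_mono)
    qed
  qed
  define B where "B = (\<lambda>z. \<Sum>n. b n * z ^ n)"
  define B' where "B' = (\<lambda>z. \<Sum>n. diffs b n * z ^ n)"
  show thesis
  proof
    fix z assume "z \<in> unit_disc"
    then have z: "cmod z < 1" by simp
    have sumsB: "(\<lambda>n. b n * z ^ n) sums B z"
      unfolding B_def by (rule summable_sums[OF summ[OF z]])
    then show "(\<lambda>n. a n / (of_nat n + c) * z ^ n) sums B z"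
      by (simp add: b_def)
    show "(B has_field_derivative B' z) (at z)"
      unfolding B_def B'_def by (rule termdiffs_strong'[OF summ z])
    have "summable (\<lambda>n. diffs b n * z ^ n)"
      by (rule termdiff_converges[OF z summ])
    from diffs_equiv[OF this] have "(\<lambda>n. z * (of_nat n * b n * z ^ (n - Suc 0))) sums (z * B' z)"
      unfolding B'_def by (rule sums_mult)
    from sums_add[OF this sums_mult[OF sumsB]]
    have "(\<lambda>n. z * (of_nat n * b n * z ^ (n - Suc 0)) + c * (b n * z ^ n)) sums (z * B' z + c * B z)" .
    moreover have "z * (of_nat n * b n * z ^ (n - Suc 0)) + c * (b n * z ^ n) = a n * z ^ n" for n
    proof -
      have "z * (of_nat n * b n * z ^ (n - Suc 0)) = of_nat n * b n * z ^ n"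
        by (cases n) auto
      then have "z * (of_nat n * b n * z ^ (n - Suc 0)) + c * (b n * z ^ n)
          = ((of_nat n + c) * b n) * z ^ n"
        by (simp add: algebra_simps)
      also have "(of_nat n + c) * b n = a n"
        using nz[of n] by (simp add: b_def)
      finally show ?thesis .
    qed
    ultimately show "z * B' z + c * B z = A z"
      using A[OF \<open>z \<in> unit_disc\<close>] sums_unique2 by simp
  qed
qed

lemma linepath_in_disc: "z \<in> unit_disc \<Longrightarrow> path_image (linepath 0 z) \<subseteq> unit_disc"
  using convex_contains_segment[of unit_disc] by (auto simp: closed_segment_subset)

lemma has_contour_integral_disc:
  assumes deriv: "\<And>z. z \<in> unit_disc \<Longrightarrow> (W has_field_derivative G z) (at z)"
    and "z \<in> unit_disc"
  shows "(G has_contour_integral (W z - W 0)) (linepath 0 z)"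
  using contour_integral_primitive[of unit_disc W G "linepath 0 z"] linepath_in_disc[OF assms(2)]
    has_field_derivative_at_within[OF deriv] by auto

text \<open>The value of the operator at 0 is prescribed separately; the differential equation
  \<open>(z v)' = G\<close> forces the matching value.\<close>
lemma value_at_0_of_id_mult_deriv:
  fixes v G :: "complex \<Rightarrow> complex"
  assumes "v holomorphic_on unit_disc"
    and "\<And>z. z \<in> unit_disc \<Longrightarrow> ((\<lambda>z. z * v z) has_field_derivative G z) (at z)"
  shows "v 0 = G 0"
proof -
  have "(v has_field_derivative deriv v 0) (at 0)"
    using holomorphic_derivI[OF assms(1), of 0] by simp
  from DERIV_mult[OF DERIV_ident this] have "((\<lambda>z. z * v z) has_field_derivative v 0) (at 0)"
    by simp
  then show ?thesis
    using assms(2)[of 0] DERIV_unique by simp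
qed

text \<open>Integrating \<open>(z v)' = G\<close> along the segment from 0 to \<open>z\<close> represents \<open>v z\<close> as the mean of
  \<open>G\<close> over this segment.\<close>
lemma norm_le_radial_mean:
  assumes v: "v holomorphic_on unit_disc" and G: "G holomorphic_on unit_disc"
    and deriv: "\<And>z. z \<in> unit_disc \<Longrightarrow> ((\<lambda>z. z * v z) has_field_derivative G z) (at z)"
    and z: "z \<in> unit_disc"
  shows "cmod (v z) \<le> radial_mean G z"
proof (cases "z = 0")
  case True
  then show ?thesis using value_at_0_of_id_mult_deriv[OF v deriv] by simp
next
  case False
  have "(G has_contour_integral z * v z) (linepath 0 z)"
    using has_contour_integral_disc[OF deriv z] by simp
  then have int: "((\<lambda>s. G (of_real s * z) * z) has_integral z * v z) {0..1}"
    unfolding has_contour_integral_linepath by (simp add: linepath_def scaleR_conv_of_real)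
  have cont: "continuous_on {0..1} (\<lambda>s. G (of_real s * z))"
    using z by (intro continuous_on_compose2[OF holomorphic_on_imp_continuous_on[OF G]] continuous_intros)
      (auto intro!: scaled_in_disc simp del: mem_ball)
  have "cmod (z * v z) \<le> integral {0..1} (\<lambda>s. cmod z * cmod (G (of_real s * z)))"
    unfolding integral_unique[OF int, symmetric]
    using int cont by (intro integral_norm_bound_integral integrable_continuous_real continuous_intros)
      (auto simp: norm_mult)
  then show ?thesis using False by (simp add: norm_mult)
qed

lemma one_minus_mult_Re_pos:
  assumes "0 \<le> t" "t < 1" "z \<in> cball 0 1" shows "0 < Re (1 - of_real t * z)"
proof -
  have "t * Re z \<le> t * 1"
    using assms complex_Re_le_cmod[of z] by (intro mult_left_mono) auto
  then show ?thesis using assms by simp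
qed

lemma one_minus_mult_not_nonpos:
  fixes z :: complex
  assumes "0 \<le> t" "t < 1" "z \<in> cball 0 1" shows "1 - of_real t * z \<notin> \<real>\<^sub>\<le>\<^sub>0"
  using one_minus_mult_Re_pos[OF assms] by (auto simp: complex_nonpos_Reals_iff)

lemma one_minus_mult_nz:
  fixes z :: complex
  assumes "0 \<le> t" "t < 1" "z \<in> unit_disc" shows "1 - of_real t * z \<noteq> 0"
  using one_minus_mult_not_nonpos[of t z] assms by auto

text \<open>The differential equation characterises the image under the operator, because \<open>z h(z)\<close>
  vanishes at 0 and is a primitive of the integrand.\<close>
lemma cesaro_eqI:
  assumes h: "h holomorphic_on unit_disc"
    and deriv: "\<And>z. z \<in> unit_disc \<Longrightarrow>
      ((\<lambda>z. z * h z) has_field_derivative f z / (1 - of_real t * z)) (at z)"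
    and z: "z \<in> unit_disc"
  shows "cesaro t f z = h z"
proof (cases "z = 0")
  case True
  then show ?thesis
    using value_at_0_of_id_mult_deriv[OF h deriv] by (simp add: cesaro_def)
next
  case False
  have "contour_integral (linepath 0 z) (\<lambda>\<xi>. f \<xi> / (1 - of_real t * \<xi>)) = z * h z"
    using has_contour_integral_disc[OF deriv z] by (simp add: contour_integral_unique)
  then show ?thesis using False z by (simp add: cesaro_def)
qed

lemma cesaro_integrand_holomorphic:
  assumes "0 \<le> t" "t < 1" "f \<in> holo_disc"
  shows "(\<lambda>z. f z / (1 - of_real t * z)) holomorphic_on unit_disc"
  using assms one_minus_mult_nz[OF assms(1,2)]
  by (auto simp: holo_disc_def intro!: holomorphic_intros simp del: mem_ball)

lemma cesaro_integrand_integrable: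
  assumes "0 \<le> t" "t < 1" "f \<in> holo_disc" "z \<in> unit_disc"
  shows "(\<lambda>\<xi>. f \<xi> / (1 - of_real t * \<xi>)) contour_integrable_on (linepath 0 z)"
  using holomorphic_on_imp_continuous_on[OF cesaro_integrand_holomorphic[OF assms(1-3)]]
    linepath_in_disc[OF assms(4)]
  by (intro contour_integrable_continuous_linepath) (auto intro: continuous_on_subset)

lemma cesaro_add:
  assumes "0 \<le> t" "t < 1" "f \<in> holo_disc" "g \<in> holo_disc"
  shows "cesaro t (\<lambda>z. f z + g z) = (\<lambda>z. cesaro t f z + cesaro t g z)"
  using assms
  by (auto simp: fun_eq_iff cesaro_def add_divide_distrib contour_integral_add
      cesaro_integrand_integrable simp flip: distrib_left)

lemma cesaro_scale:
  assumes "0 \<le> t" "t < 1" "f \<in> holo_disc"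
  shows "cesaro t (\<lambda>z. c * f z) = (\<lambda>z. c * cesaro t f z)"
  using assms
  by (auto simp: fun_eq_iff cesaro_def contour_integral_lmul cesaro_integrand_integrable
      simp flip: times_divide_eq_right)

section \<open>The resolvent\<close>

lemma complex_of_nat_plus_1:
  shows "of_nat n + 1 \<noteq> (0 :: complex)" and "cmod (of_nat n + 1) = real n + 1"
  using of_nat_neq_0[of n, where 'a = complex] norm_of_nat[of "Suc n", where 'a = complex]
  by (simp_all add: add.commute)

text \<open>The integrating factor \<open>(1 - t z)^\<nu>\<close> is taken with the principal branch, which is available
  because \<open>1 - t z\<close> has positive real part. As \<open>t < 1\<close>, this holds on the closed disc, and
  compactness bounds the factor.\<close>
lemma complex_power_bounded:
  assumes "0 \<le> t" "t < 1"
  obtains C where "0 \<le> C"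
    "\<And>z. z \<in> unit_disc \<Longrightarrow> cmod (exp (\<nu> * Ln (1 - of_real t * z))) \<le> C"
proof -
  have "continuous_on (cball 0 1) (\<lambda>z. exp (\<nu> * Ln (1 - of_real t * z)))"
    by (intro continuous_intros one_minus_mult_not_nonpos assms)
  then have "bounded ((\<lambda>z. exp (\<nu> * Ln (1 - of_real t * z))) ` cball 0 1)"
    by (intro compact_imp_bounded compact_continuous_image) auto
  then obtain C where "0 < C" "\<forall>w\<in>(\<lambda>z. exp (\<nu> * Ln (1 - of_real t * z))) ` cball 0 1. cmod w \<le> C"
    unfolding bounded_pos by blast
  then show thesis by (intro that[of C]) auto
qed

lemma complex_power_deriv:
  assumes "0 \<le> t" "t < 1" "z \<in> unit_disc"
  shows "((\<lambda>z. exp (\<nu> * Ln (1 - of_real t * z))) has_field_derivative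
    - \<nu> * of_real t / (1 - of_real t * z) * exp (\<nu> * Ln (1 - of_real t * z))) (at z)"
proof -
  have "1 - of_real t * z \<notin> \<real>\<^sub>\<le>\<^sub>0"
    using assms by (intro one_minus_mult_not_nonpos) auto
  then show ?thesis
    by (auto intro!: derivative_eq_intros simp: field_simps)
qed

lemma summable_resolvent_coeffs:
  "summable (\<lambda>n. 1 / (cmod (of_nat n + 1 - \<mu>) * (real n + 1)))"
proof (rule summable_comparison_test_ev)
  have "summable (\<lambda>n. inverse ((real (Suc n)) ^ 2))"
    using inverse_power_summable[of 2, where 'a = real] by (subst summable_Suc_iff) simp
  from summable_mult[OF this, of 2] show "summable (\<lambda>n. 2 * inverse ((real n + 1) ^ 2))"
    by (simp add: add.commute)
  show "\<forall>\<^sub>F n in sequentially. norm (1 / (cmod (of_nat n + 1 - \<mu>) * (real n + 1)))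
      \<le> 2 * inverse ((real n + 1) ^ 2)"
    using eventually_ge_at_top[of "nat \<lceil>2 * cmod \<mu>\<rceil>"]
  proof (rule eventually_mono)
    fix n assume "nat \<lceil>2 * cmod \<mu>\<rceil> \<le> n"
    then have n: "2 * cmod \<mu> \<le> real n" by (simp add: nat_le_iff ceiling_le_iff)
    have "(real n + 1) / 2 \<le> cmod (of_nat n + 1 - \<mu>)"
      using complex_of_nat_plus_1(2)[of n] norm_triangle_ineq2[of "of_nat n + 1" \<mu>] n by simp
    then have "1 / (cmod (of_nat n + 1 - \<mu>) * (real n + 1)) \<le> 1 / ((real n + 1) / 2 * (real n + 1))"
      by (intro divide_left_mono mult_right_mono mult_pos_pos) auto
    then show "norm (1 / (cmod (of_nat n + 1 - \<mu>) * (real n + 1))) \<le> 2 * inverse ((real n + 1) ^ 2)"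
      by (simp add: power2_eq_square field_simps)
  qed
qed

lemma id_mult_has_derivative:
  fixes B :: "complex \<Rightarrow> complex"
  assumes "(B has_field_derivative B') (at z)" "B z + z * B' = c"
  shows "((\<lambda>z. z * B z) has_field_derivative c) (at z)"
  using assms by (auto intro!: derivative_eq_intros)

text \<open>Besides \<open>u\<close>, let \<open>R\<close> solve \<open>z R' + R = u\<close>. Then \<open>v = u - \<mu> R\<close> satisfies
  \<open>(z v)' = (z u)' - \<mu> u = G\<close>, so \<open>v\<close> is bounded by the radial mean of \<open>G\<close>. The coefficients
  \<open>G_n / ((n + 1 - \<mu>) (n + 1))\<close> of \<open>R\<close> are absolutely summable, so \<open>R\<close> is a bounded
  function.\<close>
lemma euler_solution_bound:
  assumes p: "1 \<le> p" and g: "g \<in> hardy_space p" and G: "G holomorphic_on unit_disc"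
    and C: "0 \<le> C" and le: "\<And>z. z \<in> unit_disc \<Longrightarrow> cmod (G z) \<le> C * cmod (g z)"
    and nz: "\<And>n::nat. of_nat n + 1 - \<mu> \<noteq> 0"
  defines "S \<equiv> \<Sum>n. 1 / (cmod (of_nat n + 1 - \<mu>) * (real n + 1))"
  shows "\<exists>u u'. \<forall>z\<in>unit_disc. (u has_field_derivative u' z) (at z) \<and>
    z * u' z + (1 - \<mu>) * u z = G z \<and>
    cmod (u z) \<le> C * radial_mean g z
      + cmod \<mu> * (C * hardy_norm p g * S)"
proof -
  define a where "a n = (deriv ^^ n) G 0 / fact n" for n
  have g': "g \<in> holo_disc" using g by (simp add: hardy_space_def)
  have a_le: "cmod (a n) \<le> C * hardy_norm p g" for n
    unfolding a_def by (rule taylor_coeff_le_hardy_norm[OF p g G C le])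
  have "(\<lambda>n. a n * z ^ n) sums G z" if "z \<in> unit_disc" for z
    using holomorphic_power_series[OF G that] by (simp add: a_def)
  then obtain u u' where u:
    "\<And>z. z \<in> unit_disc \<Longrightarrow> (\<lambda>n. a n / (of_nat n + (1 - \<mu>)) * z ^ n) sums u z"
    "\<And>z. z \<in> unit_disc \<Longrightarrow> (u has_field_derivative u' z) (at z)"
    "\<And>z. z \<in> unit_disc \<Longrightarrow> z * u' z + (1 - \<mu>) * u z = G z"
    using euler_equation_solution[of "1 - \<mu>" a G] nz by (auto simp: add_diff_eq)
  obtain R R' where R:
    "\<And>z. z \<in> unit_disc \<Longrightarrow> (\<lambda>n. a n / (of_nat n + (1 - \<mu>)) / (of_nat n + 1) * z ^ n) sums R z"
    "\<And>z. z \<in> unit_disc \<Longrightarrow> (R has_field_derivative R' z) (at z)"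
    "\<And>z. z \<in> unit_disc \<Longrightarrow> z * R' z + 1 * R z = u z"
    using euler_equation_solution[of 1 "\<lambda>n. a n / (of_nat n + (1 - \<mu>))" u] u(1)
      complex_of_nat_plus_1(1) by auto
  have R_le: "cmod (R z) \<le> C * hardy_norm p g * S" if z: "z \<in> unit_disc" for z
  proof -
    let ?b = "\<lambda>n. 1 / (cmod (of_nat n + 1 - \<mu>) * (real n + 1))"
    have b: "norm (a n / (of_nat n + (1 - \<mu>)) / (of_nat n + 1) * z ^ n)
        \<le> C * hardy_norm p g * ?b n" for n
    proof -
      have "norm (a n / (of_nat n + (1 - \<mu>)) / (of_nat n + 1) * z ^ n)
          = cmod (a n) * ?b n * cmod z ^ n"
        using complex_of_nat_plus_1(2)[of n]
            by (simp add: norm_mult norm_divide norm_power add_diff_eq)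
      also have "\<dots> \<le> (C * hardy_norm p g) * ?b n * 1"
        using z a_le[of n] by (intro mult_mono order_trans[OF norm_ge_zero a_le] mult_right_mono power_le_one
            mult_nonneg_nonneg order_refl) auto
      finally show ?thesis by simp
    qed
    have "(\<lambda>n. C * hardy_norm p g * ?b n) sums (C * hardy_norm p g * S)"
      unfolding S_def by (intro sums_mult summable_sums summable_resolvent_coeffs)
    from norm_sums_le[OF R(1)[OF z] this b] show ?thesis .
  qed
  define v where "v z = u z - \<mu> * R z" for z
  have v_deriv: "(v has_field_derivative u' z - \<mu> * R' z) (at z)" if "z \<in> unit_disc" for z
    unfolding v_def[abs_def] by (intro DERIV_diff DERIV_cmult u(2) R(2) that)
  have v: "((\<lambda>z. z * v z) has_field_derivative G z) (at z)" if z: "z \<in> unit_disc" for z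
  proof (rule id_mult_has_derivative[OF v_deriv[OF z]])
    have "\<mu> * (R z + z * R' z) = \<mu> * u z" using R(3)[OF z] by (simp add: add.commute)
    then show "v z + z * (u' z - \<mu> * R' z) = G z"
      using u(3)[OF z] by (simp add: v_def algebra_simps)
  qed
  have v_holo: "v holomorphic_on unit_disc"
    unfolding holomorphic_on_open[OF open_ball] using v_deriv by blast
  show ?thesis
  proof (rule exI[of _ u], rule exI[of _ u'], intro ballI conjI)
    fix z assume z: "z \<in> unit_disc"
    have "cmod (v z) \<le> radial_mean G z"
      by (rule norm_le_radial_mean[OF v_holo G v z])
    also have "\<dots> \<le> integral {0..1} (\<lambda>s. C * cmod (g (of_real s * z)))"
    proof (rule integral_le)
      show "(\<lambda>s. cmod (G (of_real s * z))) integrable_on {0..1}"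
        using z by (intro integrable_continuous_real continuous_intros
          continuous_on_compose2[OF holomorphic_on_imp_continuous_on[OF G]])
          (auto intro!: scaled_in_disc simp del: mem_ball)
    qed (use z in \<open>auto intro!: integrable_continuous_real continuous_on_mult_left
           continuous_on_radius[OF g'] le scaled_in_disc simp del: mem_ball\<close>)
    also have "\<dots> = C * radial_mean g z" by simp
    finally have v_le: "cmod (v z) \<le> C * radial_mean g z" .
    have "cmod (u z) \<le> cmod (v z) + cmod (\<mu> * R z)"
      using norm_triangle_ineq[of "v z" "\<mu> * R z"] by (simp add: v_def)
    also have "\<dots> \<le> C * radial_mean g z + cmod \<mu> * (C * hardy_norm p g * S)"
      unfolding norm_mult by (intro add_mono v_le mult_left_mono R_le z) auto
    finally show "cmod (u z) \<le> C * radial_mean g z + cmod \<mu> * (C * hardy_norm p g * S)" .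
  qed (use u(2,3) in auto)
qed

text \<open>With \<open>h = (1 - t z)^(-\<mu>) u\<close> and \<open>f = \<mu> (g + h)\<close>, the Euler equation for \<open>u\<close> is equivalent to
  \<open>(z h)' = f / (1 - t z)\<close>, that is \<open>C f = h\<close>, which in turn says \<open>f / \<mu> - C f = g\<close>.\<close>
lemma resolvent_solution:
  assumes p: "1 \<le> p" and t: "0 \<le> t" "t < 1" and \<mu>0: "\<mu> \<noteq> 0"
    and nz: "\<And>n::nat. of_nat n + 1 - \<mu> \<noteq> 0"
  obtains K where "\<And>g. g \<in> hardy_space p \<Longrightarrow>
     \<exists>f\<in>hardy_space p. shifted_op (cesaro t) (1 / \<mu>) f = g \<and> hardy_norm p f \<le> K * hardy_norm p g"
proof -
  define P where "P \<nu> z = exp (\<nu> * Ln (1 - of_real t * z))" for \<nu> z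
  obtain C1 where C1: "0 \<le> C1" "\<And>z. z \<in> unit_disc \<Longrightarrow> cmod (P (\<mu> - 1) z) \<le> C1"
    unfolding P_def using complex_power_bounded[OF t] by blast
  obtain C2 where C2: "0 \<le> C2" "\<And>z. z \<in> unit_disc \<Longrightarrow> cmod (P (- \<mu>) z) \<le> C2"
    unfolding P_def using complex_power_bounded[OF t] by blast
  have P_deriv: "(P \<nu> has_field_derivative - \<nu> * of_real t / (1 - of_real t * z) * P \<nu> z) (at z)"
    if "z \<in> unit_disc" for \<nu> z
    using complex_power_deriv[OF t that] unfolding P_def[abs_def] .
  (* The exponents -\<mu>, \<mu> - 1 and 1 add up to 0; this turns G back into \<mu> * g in the equation for h. *)
  have PP: "P (- \<mu>) z * P (\<mu> - 1) z * (1 - of_real t * z) = 1" if "z \<in> unit_disc" for z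
  proof -
    have "P (- \<mu>) z * P (\<mu> - 1) z = exp (- Ln (1 - of_real t * z))"
      unfolding P_def by (simp add: algebra_simps flip: exp_add)
    then show ?thesis
      using one_minus_mult_nz[OF t that] by (simp add: exp_minus)
  qed
  define S where "S = (\<Sum>n. 1 / (cmod (of_nat n + 1 - \<mu>) * (real n + 1)))"
  have S0: "0 \<le> S"
    unfolding S_def by (intro suminf_nonneg summable_resolvent_coeffs) auto
  define C where "C = cmod \<mu> * C1"
  have C: "0 \<le> C" using C1 by (simp add: C_def)
  define K where "K = cmod \<mu> * (1 + C2 * C + C2 * (cmod \<mu> * (C * S)))"
  have K: "0 \<le> K" using C C2 S0 by (simp add: K_def)
  have "\<exists>f\<in>hardy_space p. shifted_op (cesaro t) (1 / \<mu>) f = g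
      \<and> hardy_norm p f \<le> (3 * K) * hardy_norm p g"
    if g: "g \<in> hardy_space p" for g
  proof -
    have g': "g \<in> holo_disc" using g by (simp add: hardy_space_def)
    then have g_holo: "g holomorphic_on unit_disc" by (simp add: holo_disc_def)
    have P_holo: "P \<nu> holomorphic_on unit_disc" for \<nu>
      unfolding holomorphic_on_open[OF open_ball] using P_deriv by blast
    define G where "G z = \<mu> * P (\<mu> - 1) z * g z" for z
    have G: "G holomorphic_on unit_disc"
      unfolding G_def[abs_def] by (intro holomorphic_intros P_holo g_holo)
    have G_le: "cmod (G z) \<le> C * cmod (g z)" if "z \<in> unit_disc" for z
      unfolding G_def C_def norm_mult using C1(2)[OF that]
      by (intro mult_right_mono mult_left_mono) auto
    from euler_solution_bound[OF p g G C G_le nz, folded S_def]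
    obtain u u' where
      u: "\<And>z. z \<in> unit_disc \<Longrightarrow> (u has_field_derivative u' z) (at z)"
      and ode: "\<And>z. z \<in> unit_disc \<Longrightarrow> z * u' z + (1 - \<mu>) * u z = G z"
      and u_le: "\<And>z. z \<in> unit_disc \<Longrightarrow> cmod (u z) \<le>
       C * radial_mean g z + cmod \<mu> * (C * hardy_norm p g * S)"
      by blast
    define h where "h z = P (- \<mu>) z * u z" for z
    define f where "f z = (if z \<in> unit_disc then \<mu> * (g z + h z) else 0)" for z
    have u_holo: "u holomorphic_on unit_disc"
      unfolding holomorphic_on_open[OF open_ball] using u by blast
    then have h_holo: "h holomorphic_on unit_disc"
      unfolding h_def[abs_def] by (intro holomorphic_intros P_holo)
    have f_holo: "f \<in> holo_disc"
    proof -
      have "(\<lambda>z. \<mu> * (g z + h z)) holomorphic_on unit_disc"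
        by (intro holomorphic_intros g_holo h_holo)
      then have "f holomorphic_on unit_disc"
        by (rule holomorphic_transform) (simp add: f_def)
      then show ?thesis by (simp add: holo_disc_def f_def)
    qed
    have "((\<lambda>z. z * h z) has_field_derivative f z / (1 - of_real t * z)) (at z)"
        if z: "z \<in> unit_disc" for z
    proof (rule id_mult_has_derivative)
      define w where "w = 1 - of_real t * z"
      have w: "w \<noteq> 0" using one_minus_mult_nz[OF t z] by (simp add: w_def)
      define h' where "h' = \<mu> * of_real t / w * P (- \<mu>) z * u z + P (- \<mu>) z * u' z"
      show "(h has_field_derivative h') (at z)"
        unfolding h_def[abs_def] h'_def w_def
        using DERIV_mult[OF P_deriv[OF z, of "- \<mu>"] u[OF z]] by (simp add: algebra_simps)
      have "z * u' z = G z - (1 - \<mu>) * u z" using ode[OF z] by (simp add: algebra_simps)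
      moreover have "z * of_real t = 1 - w" by (simp add: w_def)
      moreover have "h z + z * h'
          = P (- \<mu>) z * u z + \<mu> * (z * of_real t) / w * P (- \<mu>) z * u z + P (- \<mu>) z * (z * u' z)"
        by (simp add: h_def h'_def algebra_simps)
      ultimately have "h z + z * h'
          = P (- \<mu>) z * u z + \<mu> * (1 - w) / w * P (- \<mu>) z * u z + P (- \<mu>) z * (G z - (1 - \<mu>) * u z)"
        by simp
      then have "w * (h z + z * h') = \<mu> * h z + P (- \<mu>) z * w * G z"
        using w by (simp add: h_def field_simps)
      also have "P (- \<mu>) z * w * G z = \<mu> * g z"
        using PP[OF z] by (simp add: G_def w_def mult_ac)
      finally have "w * (h z + z * h') = f z" using z by (simp add: f_def algebra_simps)
      then show "h z + z * h' = f z / (1 - of_real t * z)"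
        unfolding w_def[symmetric] using w by (simp add: field_simps)
    qed
    then have "cesaro t f z = h z" if "z \<in> unit_disc" for z
      using cesaro_eqI[OF h_holo] that by blast
    then have eq: "shifted_op (cesaro t) (1 / \<mu>) f = g"
      using \<mu>0 g' by (auto simp: fun_eq_iff shifted_op_def f_def cesaro_def holo_disc_def field_simps)
    have dom: "cmod (f z) \<le> K * (cmod (g z) + radial_mean g z + hardy_norm p g)"
      if z: "z \<in> unit_disc" for z
    proof -
      define I where "I = radial_mean g z"
      have I0: "0 \<le> I"
        unfolding I_def
        by (rule radial_mean_nonneg[OF g' z])
      have N0: "0 \<le> hardy_norm p g" by (rule hardy_norm_nonneg[OF g])
      have "cmod (h z) \<le> C2 * (C * I + cmod \<mu> * (C * hardy_norm p g * S))"
        unfolding h_def norm_mult I_def using C2 u_le[OF z] z by (intro mult_mono) auto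
      then have "cmod (f z) \<le> cmod \<mu> * (cmod (g z) + C2 * (C * I + cmod \<mu> * (C * hardy_norm p g * S)))"
        using z norm_triangle_ineq[of "g z" "h z"]
            by (auto simp: f_def norm_mult intro!: mult_left_mono)
      also have "\<dots> \<le> K * (cmod (g z) + I + hardy_norm p g)"
      proof -
        define x where "x = C2 * C"
        define y where "y = C2 * (cmod \<mu> * (C * S))"
        have xy: "0 \<le> x" "0 \<le> y" using C C2 S0 by (simp_all add: x_def y_def)
        have "cmod (g z) + (x * I + y * hardy_norm p g)
            \<le> (1 + x + y) * (cmod (g z) + I + hardy_norm p g)"
          using xy I0 N0 by (simp add: algebra_simps)
        then have "cmod \<mu> * (cmod (g z) + (x * I + y * hardy_norm p g))
            \<le> cmod \<mu> * ((1 + x + y) * (cmod (g z) + I + hardy_norm p g))"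
          by (rule mult_left_mono) simp
        then show ?thesis by (simp add: K_def x_def y_def algebra_simps)
      qed
      finally show ?thesis by (simp add: I_def)
    qed
    show ?thesis
      using hardy_space_dominated[OF p g f_holo K dom] eq by auto
  qed
  then show thesis by (rule that)
qed

section \<open>Eigenvalues and eigenfunctions\<close>

text \<open>Since \<open>z d(z)\<close> vanishes at 0 and is not constant, it factors as \<open>z^n g(z)\<close> with \<open>n > 0\<close> and
  \<open>g 0 \<noteq> 0\<close>. Inserting this in \<open>(\<alpha> z d)' = d / (1 - t z)\<close>, multiplying by \<open>z\<close> and cancelling
  \<open>z^n\<close> gives an identity that extends continuously to 0, where it reads
  \<open>\<alpha> n g 0 = g 0\<close>. The value \<open>\<alpha> = 0\<close> is excluded by the same computation.\<close>
lemma cesaro_eigenvalue: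
  assumes t: "0 \<le> t" "t < 1" and d: "d \<in> holo_disc" "d \<noteq> (\<lambda>z. 0)"
    and eig: "\<And>z. z \<in> unit_disc \<Longrightarrow> cesaro t d z = \<alpha> * d z"
  shows "\<exists>m::nat. \<alpha> = 1 / (of_nat m + 1)"
proof -
  have d_holo: "d holomorphic_on unit_disc" using d by (simp add: holo_disc_def)
  define q where "q z = d z / (1 - of_real t * z)" for z
  have "q holomorphic_on unit_disc"
    unfolding q_def[abs_def] by (rule cesaro_integrand_holomorphic[OF t d(1)])
  then obtain H where H: "\<And>z. z \<in> unit_disc \<Longrightarrow> (H has_field_derivative q z) (at z)"
    using holomorphic_convex_primitive'[of unit_disc q]
        by (auto simp: at_within_open[of _ unit_disc])
  have prim: "H z - H 0 = \<alpha> * (z * d z)" if z: "z \<in> unit_disc" for z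
  proof (cases "z = 0")
    case False
    have "contour_integral (linepath 0 z) q = H z - H 0"
      using has_contour_integral_disc[OF H z] by (rule contour_integral_unique)
    then have "cesaro t d z = (H z - H 0) / z"
      using z False by (simp add: cesaro_def q_def[abs_def])
    then show ?thesis using eig[OF z] False by (simp add: field_simps)
  qed simp
  have deriv: "((\<lambda>z. \<alpha> * (z * d z)) has_field_derivative q z) (at z)" if z: "z \<in> unit_disc" for z
  proof -
    have "((\<lambda>z. H z - H 0) has_field_derivative q z) (at z)"
      using H[OF z] by (auto intro!: derivative_eq_intros)
    then show ?thesis
      by (rule has_field_derivative_transform_within_open[where S = unit_disc]) (use z prim in auto)
  qed
  obtain z1 where z1: "d z1 \<noteq> 0" using d(2) by auto
  then have z1_disc: "z1 \<in> unit_disc" using d(1) by (auto simp: holo_disc_def)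
  have nonconst: "\<not> (\<lambda>z. z * d z) constant_on unit_disc"
  proof
    assume "(\<lambda>z. z * d z) constant_on unit_disc"
    then obtain c where c: "\<And>z. z \<in> unit_disc \<Longrightarrow> z * d z = c"
      by (auto simp: constant_on_def)
    then have zero: "z * d z = 0" if "z \<in> unit_disc" for z
      using c[of 0] c[OF that] by simp
    then have "z1 = 0" using z1 z1_disc by auto
    moreover have "d 0 = 0"
      by (rule value_at_0_of_id_mult_deriv[OF d_holo, of "\<lambda>_. 0"])
         (rule has_field_derivative_transform_within_open[OF DERIV_const[of 0] open_ball[of 0 1]], use zero in auto)
    ultimately show False using z1 by simp
  qed
  have "(\<lambda>z. z * d z) holomorphic_on unit_disc"
    by (intro holomorphic_intros d_holo)
  then have "\<exists>g r n. 0 < n \<and> 0 < r \<and> ball 0 r \<subseteq> unit_disc \<and> g holomorphic_on ball 0 r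
      \<and> (\<forall>w\<in>ball 0 r. w * d w = w ^ n * g w \<and> g w \<noteq> 0)"
    by (rule holomorphic_factor_zero_nonconstant[OF _ open_ball connected_ball _ _ nonconst, of 0])
       (simp, simp, metis diff_zero)
  then obtain g r n where n: "0 < n" and r: "0 < r" "ball 0 r \<subseteq> unit_disc"
    and g: "g holomorphic_on ball 0 r"
    and fac: "\<And>w. w \<in> ball 0 r \<Longrightarrow> w * d w = w ^ n * g w"
    and g_nz: "\<And>w. w \<in> ball 0 r \<Longrightarrow> g w \<noteq> 0"
    by blast
  define \<phi> where "\<phi> z = \<alpha> * (of_nat n * g z + z * deriv g z) - g z / (1 - of_real t * z)" for z
  (* Compare the two expressions for the derivative of \<alpha> * z ^ n * g z away from 0. *)
  have zero: "\<phi> z = 0" if z: "z \<in> ball 0 r" "z \<noteq> 0" for z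
  proof -
    have z': "z \<in> unit_disc" using z r by blast
    have "((\<lambda>z. \<alpha> * (z ^ n * g z)) has_field_derivative q z) (at z)"
      by (rule has_field_derivative_transform_within_open[OF deriv[OF z'] open_ball z(1)])
         (use fac in auto)
    moreover have "((\<lambda>z. \<alpha> * (z ^ n * g z)) has_field_derivative
        \<alpha> * (of_nat n * z ^ (n - 1) * g z + z ^ n * deriv g z)) (at z)"
      using holomorphic_derivI[OF g open_ball z(1)] by (auto intro!: derivative_eq_intros)
    ultimately have "\<alpha> * (of_nat n * z ^ (n - 1) * g z + z ^ n * deriv g z) = q z"
      by (rule DERIV_unique[symmetric])
    then have "z * (\<alpha> * (of_nat n * z ^ (n - 1) * g z + z ^ n * deriv g z))
        = (z * d z) / (1 - of_real t * z)"
      by (simp add: q_def)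
    also have "z * (\<alpha> * (of_nat n * z ^ (n - 1) * g z + z ^ n * deriv g z))
        = z ^ n * (\<alpha> * (of_nat n * g z + z * deriv g z))"
      using n by (cases n) (auto simp: algebra_simps)
    also have "(z * d z) / (1 - of_real t * z) = z ^ n * (g z / (1 - of_real t * z))"
      using fac[OF z(1)] by simp
    finally have "\<alpha> * (of_nat n * g z + z * deriv g z) = g z / (1 - of_real t * z)"
      using z by (subst (asm) mult_cancel_left) simp
    then show ?thesis by (simp add: \<phi>_def)
  qed
  have "continuous_on (ball 0 r) \<phi>"
    unfolding \<phi>_def[abs_def] using one_minus_mult_nz[OF t] r(2)
    by (intro continuous_intros holomorphic_on_imp_continuous_on[OF g]
          holomorphic_on_imp_continuous_on[OF holomorphic_deriv[OF g]]) blast+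
  then have "(\<phi> \<longlongrightarrow> \<phi> 0) (at 0)"
    using r by (simp add: continuous_on_eq_continuous_at continuous_at isCont_def)
  moreover have "(\<phi> \<longlongrightarrow> 0) (at 0)"
    by (rule tendsto_eventually) (use zero r in \<open>auto simp: eventually_at intro!: exI[of _ r]\<close>)
  ultimately have "\<phi> 0 = 0" by (rule tendsto_unique[rotated]) simp
  then have "\<alpha> * of_nat n = 1"
    using g_nz[of 0] r by (simp add: \<phi>_def algebra_simps)
  (* n is the order of z * d z at 0, one more than the order of d. *)
  then have "\<alpha> = 1 / (of_nat (n - 1) + 1)"
    using n by (simp add: field_simps of_nat_diff)
  then show ?thesis by blast
qed

text \<open>For \<open>f = z^m / (1 - t z)^(m + 1)\<close> one has \<open>z f = w^(m + 1)\<close> with \<open>w = z / (1 - t z)\<close>, and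
  \<open>w' = 1 / (1 - t z)^2\<close>; hence \<open>(z f)' = (m + 1) f / (1 - t z)\<close>.\<close>
lemma cesaro_eigenfunction:
  assumes p: "1 \<le> p" and t: "0 \<le> t" "t < 1"
  obtains f where "f \<in> hardy_space p" "f \<noteq> (\<lambda>z. 0)"
    "shifted_op (cesaro t) (1 / (of_nat m + 1)) f = (\<lambda>z. 0)"
proof
  define e where "e z = z ^ m / (1 - of_real t * z) ^ (m + 1)" for z :: complex
  define f where "f z = (if z \<in> unit_disc then e z else 0)" for z
  have nz: "1 - of_real t * z \<noteq> 0" if "z \<in> cball 0 1" for z :: complex
    using one_minus_mult_not_nonpos[OF t that] by auto
  have e_holo: "e holomorphic_on unit_disc"
    unfolding e_def[abs_def] using nz by (intro holomorphic_intros) auto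
  have f_holo: "f \<in> holo_disc"
    using holomorphic_transform[OF e_holo, of f] by (simp add: holo_disc_def f_def)
  have "continuous_on (cball 0 1) e"
    unfolding e_def[abs_def] using nz by (intro continuous_intros) auto
  then have "bounded (e ` cball 0 1)"
    by (intro compact_imp_bounded compact_continuous_image) auto
  then obtain B where "\<forall>w\<in>e ` cball 0 1. cmod w \<le> B"
    unfolding bounded_iff by blast
  then show "f \<in> hardy_space p"
    by (intro hardy_space_bounded(1)[OF p f_holo, of B]) (auto simp: f_def)
  have "f (1/2) \<noteq> 0"
    using nz[of "1/2"] by (simp add: f_def e_def)
  then show "f \<noteq> (\<lambda>z. 0)" by auto
  let ?h = "\<lambda>z. 1 / (of_nat m + 1) * e z"
  note m1 = complex_of_nat_plus_1(1)[of m]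
  have "cesaro t f z = ?h z" if z: "z \<in> unit_disc" for z
  proof (rule cesaro_eqI[OF _ _ z])
    show "?h holomorphic_on unit_disc" by (intro holomorphic_intros e_holo)
    fix z assume z: "z \<in> unit_disc"
    define w where "w = 1 - of_real t * z"
    have w: "w \<noteq> 0" using nz[of z] z by (simp add: w_def)
    have "((\<lambda>z. z / (1 - of_real t * z)) has_field_derivative 1 / (w * w)) (at z)"
      using w by (auto intro!: derivative_eq_intros simp: w_def)
    from DERIV_cdivide[OF DERIV_power[OF this, of "Suc m"], of "of_nat m + 1"]
    have "((\<lambda>z. (z / (1 - of_real t * z)) ^ Suc m / (of_nat m + 1)) has_field_derivative
       (of_nat m + 1) * (1 / (w * w) * (z / w) ^ m) / (of_nat m + 1)) (at z)"
      by (simp add: w_def add.commute)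
    moreover have "(of_nat m + 1) * (1 / (w * w) * (z / w) ^ m) / (of_nat m + 1) = f z / w"
      using w z m1 by (simp add: f_def e_def w_def[symmetric] power_divide)
    moreover have "(\<lambda>z. z * ?h z) = (\<lambda>z. (z / (1 - of_real t * z)) ^ Suc m / (of_nat m + 1))"
      by (auto simp: fun_eq_iff e_def power_divide)
    ultimately show "((\<lambda>z. z * ?h z) has_field_derivative f z / (1 - of_real t * z)) (at z)"
      by (simp only: w_def)
  qed
  then show "shifted_op (cesaro t) (1 / (of_nat m + 1)) f = (\<lambda>z. 0)"
    by (auto simp: fun_eq_iff shifted_op_def f_def cesaro_def)
qed

section \<open>The spectra\<close>

lemma shifted_cesaro_add:
  assumes "0 \<le> t" "t < 1" "f \<in> hardy_space p" "g \<in> hardy_space p"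
  shows "shifted_op (cesaro t) \<alpha> (\<lambda>z. f z + g z)
      = (\<lambda>z. shifted_op (cesaro t) \<alpha> f z + shifted_op (cesaro t) \<alpha> g z)"
  using assms by (auto simp: hardy_space_def shifted_op_def cesaro_add algebra_simps)

lemma shifted_cesaro_scale:
  assumes "0 \<le> t" "t < 1" "f \<in> hardy_space p"
  shows "shifted_op (cesaro t) \<alpha> (\<lambda>z. c * f z) = (\<lambda>z. c * shifted_op (cesaro t) \<alpha> f z)"
  using assms by (auto simp: hardy_space_def shifted_op_def cesaro_scale algebra_simps)

lemma zero_in_hardy_space: "1 \<le> p \<Longrightarrow> (\<lambda>z. 0) \<in> hardy_space p"
  by (rule hardy_space_bounded(1)[of _ _ 0]) (auto simp: holo_disc_def)

lemma shifted_cesaro_zero: "shifted_op (cesaro t) \<alpha> (\<lambda>z. 0) = (\<lambda>z. 0)"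
  by (auto simp: shifted_op_def cesaro_def)

lemma point_spectrum_cesaro:
  assumes p: "1 \<le> p" and t: "0 \<le> t" "t < 1"
  shows "point_spectrum (hardy_space p) (cesaro t) = {1 / (of_nat m + 1) | m :: nat. True}"
proof (intro equalityI subsetI)
  fix \<alpha> assume "\<alpha> \<in> point_spectrum (hardy_space p) (cesaro t)"
  then obtain f g where fg: "f \<in> hardy_space p" "g \<in> hardy_space p" "f \<noteq> g"
    and eq: "shifted_op (cesaro t) \<alpha> f = shifted_op (cesaro t) \<alpha> g"
    by (auto simp: point_spectrum_def inj_on_def)
  define d where "d = (\<lambda>z. f z + (- 1) * g z)"
  have g_neg: "(\<lambda>z. (- 1) * g z) \<in> hardy_space p"
    by (rule hardy_space_scale[OF p fg(2)])
  have d: "d \<in> hardy_space p"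
    unfolding d_def by (rule hardy_space_add[OF p fg(1) g_neg])
  have "shifted_op (cesaro t) \<alpha> d = (\<lambda>z. 0)"
    unfolding d_def shifted_cesaro_add[OF t fg(1) g_neg]
      shifted_cesaro_scale[OF t fg(2)] eq by simp
  then have "cesaro t d z = \<alpha> * d z" for z
    by (auto simp: shifted_op_def dest!: fun_cong[of _ _ z])
  moreover have "d \<noteq> (\<lambda>z. 0)" using fg(3) by (auto simp: d_def fun_eq_iff)
  ultimately have "\<exists>m::nat. \<alpha> = 1 / (of_nat m + 1)"
    using cesaro_eigenvalue[OF t, of d \<alpha>] d by (simp add: hardy_space_def)
  then show "\<alpha> \<in> {1 / (of_nat m + 1) | m :: nat. True}" by simp
next
  fix \<alpha> :: complex assume "\<alpha> \<in> {1 / (of_nat m + 1) | m :: nat. True}"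
  then obtain m :: nat where "\<alpha> = 1 / (of_nat m + 1)" by blast
  then obtain f where f: "f \<in> hardy_space p" "f \<noteq> (\<lambda>z. 0)"
    "shifted_op (cesaro t) \<alpha> f = (\<lambda>z. 0)"
    using cesaro_eigenfunction[OF p t] by metis
  have "\<not> inj_on (shifted_op (cesaro t) \<alpha>) (hardy_space p)"
    using inj_onD[of "shifted_op (cesaro t) \<alpha>" "hardy_space p" f "\<lambda>z. 0"] f
      zero_in_hardy_space[OF p] shifted_cesaro_zero[of t \<alpha>] by auto
  then show "\<alpha> \<in> point_spectrum (hardy_space p) (cesaro t)"
    by (simp add: point_spectrum_def)
qed

lemma point_spectrum_subset_spectrum: "point_spectrum X T \<subseteq> spectrum X N T"
  unfolding point_spectrum_def spectrum_def by (auto intro: inj_on_inverseI)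

text \<open>The functions \<open>f = (n + 1) (1 - t z) z^n\<close> are mapped to \<open>z^n\<close>, whose norm is at most 1,
  while on the circle of radius \<open>r\<close> their modulus is at least \<open>(1 - t) (n + 1) r^n\<close>. An inverse
  with bound \<open>K\<close> would therefore satisfy \<open>|K| \<ge> (1 - t) (n + 1)\<close> for all \<open>n\<close>.\<close>
lemma zero_in_spectrum_cesaro:
  assumes p: "1 \<le> p" and t: "0 \<le> t" "t < 1"
  shows "0 \<in> spectrum (hardy_space p) (hardy_norm p) (cesaro t)"
proof (rule ccontr)
  assume "0 \<notin> spectrum (hardy_space p) (hardy_norm p) (cesaro t)"
  then obtain S K where K: "\<And>f. f \<in> hardy_space p \<Longrightarrow> hardy_norm p (S f) \<le> K * hardy_norm p f"
    and S: "\<And>f. f \<in> hardy_space p \<Longrightarrow> S (shifted_op (cesaro t) 0 f) = f"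
    unfolding spectrum_def bounded_operator_on_def by blast
  have K_ge: "(1 - t) * (real n + 1) \<le> \<bar>K\<bar>" for n
  proof (rule le_by_radial_limit)
    fix r :: real assume r: "0 < r" "r < 1"
    (* The shifted operator at 0 is the negative of the operator, hence the sign in e. *)
    define e where "e z = (if z \<in> unit_disc then - (z ^ n) else 0)" for z :: complex
    define f where "f z = (if z \<in> unit_disc then (1 - of_real t * z) * ((of_nat n + 1) * z ^ n) else 0)" for z
    have "(\<lambda>z. - (z ^ n)) holomorphic_on unit_disc" by (intro holomorphic_intros)
    then have e_holo: "e \<in> holo_disc"
      using holomorphic_transform[of _ unit_disc e] by (auto simp: holo_disc_def e_def)
    have "(\<lambda>z. (1 - of_real t * z) * ((of_nat n + 1) * z ^ n)) holomorphic_on unit_disc"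
      by (intro holomorphic_intros)
    then have f_holo: "f \<in> holo_disc"
      using holomorphic_transform[of _ unit_disc f] by (auto simp: holo_disc_def f_def)
    have e: "e \<in> hardy_space p" "hardy_norm p e \<le> 1"
      using hardy_space_bounded[OF p e_holo, of 1] by (auto simp: e_def norm_power power_le_one)
    note n1 = complex_of_nat_plus_1(2)[of n]
    have "cmod (f z) \<le> 2 * (real n + 1)" if z: "z \<in> unit_disc" for z
    proof -
      have "cmod (1 - of_real t * z) \<le> 1 + t * cmod z"
        using norm_triangle_ineq4[of 1 "of_real t * z"] t by (simp add: norm_mult)
      also have "\<dots> \<le> 2" using t z mult_left_le_one_le[of "cmod z" t] by simp
      finally have "cmod (1 - of_real t * z) * ((real n + 1) * cmod z ^ n) \<le> 2 * ((real n + 1) * 1)"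
        using z by (intro mult_mono mult_left_mono power_le_one) auto
      then show ?thesis using z by (simp add: f_def norm_mult n1 norm_power)
    qed
    then have f: "f \<in> hardy_space p" using hardy_space_bounded[OF p f_holo] by blast
    have "cesaro t f z = z ^ n" if z: "z \<in> unit_disc" for z
    proof (rule cesaro_eqI[OF _ _ z])
      fix z assume z: "z \<in> unit_disc"
      have "((\<lambda>z. z * z ^ n) has_field_derivative (of_nat n + 1) * z ^ n) (at z)"
        using DERIV_power[OF DERIV_ident, of "Suc n" z] by (simp add: add.commute)
      then show "((\<lambda>z. z * z ^ n) has_field_derivative f z / (1 - of_real t * z)) (at z)"
        using z one_minus_mult_nz[OF t z] by (simp add: f_def)
    qed (intro holomorphic_intros)
    then have "shifted_op (cesaro t) 0 f = e"
      by (auto simp: fun_eq_iff shifted_op_def e_def cesaro_def)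
    then have "hardy_norm p f \<le> K * hardy_norm p e"
      using K[OF e(1)] S[OF f] by simp
    also have "\<dots> \<le> \<bar>K\<bar> * 1"
      using e hardy_norm_nonneg[OF e(1)] by (intro mult_mono) auto
    finally have f_le: "hardy_norm p f \<le> \<bar>K\<bar>" by simp
    have "(1 - t) * (real n + 1) * r ^ n \<le> hardy_norm p f"
    proof (rule hardy_norm_ge[OF p f])
      fix z assume z: "cmod z = r"
      have "1 - t \<le> 1 - t * r" using t r mult_left_le[of r t] by simp
      also have "\<dots> \<le> cmod (1 - of_real t * z)"
        using norm_triangle_ineq2[of 1 "of_real t * z"] t z by (simp add: norm_mult)
      finally have "(1 - t) * ((real n + 1) * r ^ n)
          \<le> cmod (1 - of_real t * z) * ((real n + 1) * r ^ n)"
        using r by (intro mult_right_mono) auto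
      then show "(1 - t) * (real n + 1) * r ^ n \<le> cmod (f z)"
        using z r by (simp add: f_def norm_mult n1 norm_power mult.assoc)
    qed (use r t in auto)
    then show "(1 - t) * (real n + 1) * r ^ n \<le> \<bar>K\<bar>" using f_le by simp
  qed
  obtain n where "\<bar>K\<bar> / (1 - t) < real n" using reals_Archimedean2 by blast
  then show False using t K_ge[of n] by (simp add: field_simps)
qed

text \<open>Outside the point spectrum \<open>\<alpha> I - C\<close> is injective, and \<open>resolvent_solution\<close> gives
  surjectivity with a norm bound. The set-theoretic inverse is then linear and bounded.\<close>
lemma spectrum_cesaro_subset:
  assumes p: "1 \<le> p" and t: "0 \<le> t" "t < 1"
    and \<alpha>: "\<alpha> \<in> spectrum (hardy_space p) (hardy_norm p) (cesaro t)" "\<alpha> \<noteq> 0"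
  shows "\<exists>m::nat. \<alpha> = 1 / (of_nat m + 1)"
proof (rule ccontr)
  let ?X = "hardy_space p" and ?T = "shifted_op (cesaro t) \<alpha>"
  assume no: "\<nexists>m::nat. \<alpha> = 1 / (of_nat m + 1)"
  have "of_nat n + 1 - 1 / \<alpha> \<noteq> 0" for n
  proof
    assume "of_nat n + 1 - 1 / \<alpha> = 0"
    then have "1 / \<alpha> = of_nat n + 1" by simp
    then have "\<alpha> = 1 / (of_nat n + 1)" by (metis div_by_1 divide_divide_eq_right mult_1)
    then show False using no by blast
  qed
  then obtain K where K: "\<And>g. g \<in> ?X \<Longrightarrow> \<exists>f\<in>?X. ?T f = g \<and> hardy_norm p f \<le> K * hardy_norm p g"
    using resolvent_solution[OF p t, of "1 / \<alpha>"] \<alpha>(2) by auto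
  have "\<alpha> \<notin> point_spectrum ?X (cesaro t)"
    using no point_spectrum_cesaro[OF p t] by auto
  then have inj: "inj_on ?T ?X" by (simp add: point_spectrum_def)
  define S where "S = inv_into ?X ?T"
  have S_T: "S (?T f) = f" if "f \<in> ?X" for f
    unfolding S_def by (rule inv_into_f_f[OF inj that])
  have S: "S g \<in> ?X \<and> ?T (S g) = g \<and> hardy_norm p (S g) \<le> K * hardy_norm p g" if "g \<in> ?X" for g
    using K[OF that] S_T by metis
  have "bounded_operator_on ?X (hardy_norm p) S"
    unfolding bounded_operator_on_def
  proof (intro conjI allI ballI)
    show "S (\<lambda>z. f z + g z) = (\<lambda>z. S f z + S g z)" if "f \<in> ?X" "g \<in> ?X" for f g
      using S_T[OF hardy_space_add[OF p, of "S f" "S g"]] shifted_cesaro_add[OF t, of "S f" p "S g"]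
        S[OF that(1)] S[OF that(2)] by simp
    show "S (\<lambda>z. c * f z) = (\<lambda>z. c * S f z)" if "f \<in> ?X" for c f
      using S_T[OF hardy_space_scale[OF p, of "S f" c]] shifted_cesaro_scale[OF t, of "S f" p]
        S[OF that] by simp
    show "\<exists>K. \<forall>f\<in>?X. hardy_norm p (S f) \<le> K * hardy_norm p f" using S by blast
  qed (use S in blast)
  then have "\<alpha> \<notin> spectrum ?X (hardy_norm p) (cesaro t)"
    using S S_T by (auto simp: spectrum_def)
  then show False using \<alpha>(1) by blast
qed

theorem proposition3p11:
  fixes p t :: real
  assumes "1 \<le> p" and "0 \<le> t" and "t < 1"
  shows "point_spectrum (hardy_space p) (cesaro t)
           = {1 / (of_nat m + 1) | m :: nat. True}
       \<and> spectrum (hardy_space p) (hardy_norm p) (cesaro t)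
           = {1 / (of_nat m + 1) | m :: nat. True} \<union> {0}"
proof
  show pt: "point_spectrum (hardy_space p) (cesaro t) = {1 / (of_nat m + 1) | m :: nat. True}"
    by (rule point_spectrum_cesaro[OF assms])
  have "{1 / (of_nat m + 1) | m :: nat. True} \<subseteq> spectrum (hardy_space p) (hardy_norm p) (cesaro t)"
    using point_spectrum_subset_spectrum unfolding pt[symmetric] .
  then show "spectrum (hardy_space p) (hardy_norm p) (cesaro t)
      = {1 / (of_nat m + 1) | m :: nat. True} \<union> {0}"
    using zero_in_spectrum_cesaro[OF assms] spectrum_cesaro_subset[OF assms] by blast
qed

end
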